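(* Let $G=(V,E)$ be a finite simple graph with $V\neq\emptyset$ and $E\neq\emptyset$, and fix $e\in E$. For $i\geq 1$ let $$a_i(G)=\sum_{\substack{F\subseteq E\\ k(F)=i}}(-1)^{|F|}.$$ Let $b_e^0(G)=0$ and, for $i\geq 1$, $$b_e^i(G)=\sum_{F\in\mathcal{B}_e^i}(-1)^{|F|},$$ where $\mathcal{B}_e^i$ is the collection of all $F\subseteq E$ such that $e$ is a bridge in $F$ and $k(F)=i$. Then for all $i\geq 1$, $$a_i(G)=b_e^i(G)-b_e^{i-1}(G).$$
   Context: For $F\subseteq E$, $k(F)$ denotes the number of connected components of the spanning subgraph $(V,F)$ (isolated vertices count as components). An edge $e$ is a bridge in $F$ if $e\in F$ and $k(F\setminus\{e\})=k(F)+1$. The numbers $a_i(G)$, $1\leq i\leq |V|$, are the coefficients of the chromatic polynomial of $G$, $\chi_G(\lambda)=\sum_{i=1}^{|V|}a_i(G)\lambda^i$. *)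

theory Defs
  imports Main
begin

text \<open>A graph is a pair of a vertex set and a set of edges, an edge being the two-element set
  of its end points; thus there are neither loops nor parallel edges.\<close>

definition simple_graph :: "'a set \<Rightarrow> 'a set set \<Rightarrow> bool" where
  "simple_graph V E \<longleftrightarrow> (\<forall>e\<in>E. e \<subseteq> V \<and> card e = 2)"

definition finite_simple_graph :: "'a set \<Rightarrow> 'a set set \<Rightarrow> bool" where
  "finite_simple_graph V E \<longleftrightarrow> finite V \<and> simple_graph V E"

definition connected_rel :: "'a set \<Rightarrow> 'a set set \<Rightarrow> ('a \<times> 'a) set" where
  "connected_rel V F = {(u, v). u \<in> V \<and> v \<in> V \<and> (u, v) \<in> {(x, y). {x, y} \<in> F}\<^sup>*}"

lemma equiv_connected_rel: "equiv V (connected_rel V F)"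
proof (rule equivI)
  show "connected_rel V F \<subseteq> V \<times> V"
    by (auto simp: connected_rel_def)
  show "refl_on V (connected_rel V F)"
    by (auto simp: connected_rel_def refl_on_def)
  have "sym {(x, y). {x, y} \<in> F}"
    by (auto simp: sym_def insert_commute)
  then have "sym ({(x, y). {x, y} \<in> F}\<^sup>*)"
    by (rule sym_rtrancl)
  then show "sym (connected_rel V F)"
    by (auto simp: connected_rel_def sym_def)
  show "trans (connected_rel V F)"
    by (auto simp: connected_rel_def trans_def)
qed

text \<open>The vertex sets of the connected components of the spanning subgraph with edge set
  \<open>F\<close> are the classes of \<open>connected_rel V F\<close>; an isolated vertex is a class of its own.\<close>

definition num_components :: "'a set \<Rightarrow> 'a set set \<Rightarrow> nat" where
  "num_components V F = card (V // connected_rel V F)"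

definition is_bridge :: "'a set \<Rightarrow> 'a set set \<Rightarrow> 'a set \<Rightarrow> bool" where
  "is_bridge V F e \<longleftrightarrow> e \<in> F \<and> num_components V (F - {e}) = num_components V F + 1"

definition chrom_coeff :: "'a set \<Rightarrow> 'a set set \<Rightarrow> nat \<Rightarrow> int" where
  "chrom_coeff V E i = (\<Sum>F | F \<subseteq> E \<and> num_components V F = i. (- 1) ^ card F)"

definition bridge_sets :: "'a set \<Rightarrow> 'a set set \<Rightarrow> 'a set \<Rightarrow> nat \<Rightarrow> 'a set set set" where
  "bridge_sets V E e i = {F. F \<subseteq> E \<and> is_bridge V F e \<and> num_components V F = i}"

definition bridge_coeff :: "'a set \<Rightarrow> 'a set set \<Rightarrow> 'a set \<Rightarrow> nat \<Rightarrow> int" where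
  "bridge_coeff V E e i = (if i = 0 then 0 else \<Sum>F\<in>bridge_sets V E e i. (- 1) ^ card F)"

end

theory Submission
  imports Defs
begin

text \<open>Pair each \<open>H \<subseteq> E - {e}\<close> with \<open>H \<union> {e}\<close>. Adding \<open>e\<close> to \<open>H\<close> either keeps the number of
  components, and then the two terms of \<open>H\<close> and \<open>H \<union> {e}\<close> in \<open>a\<^sub>i\<close> cancel, or lowers it by one,
  which says that \<open>e\<close> is a bridge in \<open>H \<union> {e}\<close>. In the latter case \<open>H \<union> {e}\<close> contributes to
  \<open>b\<^sub>e\<^sup>i\<close> if it has \<open>i\<close> components, whereas \<open>H\<close> has \<open>i\<close> components precisely if \<open>H \<union> {e}\<close> has
  \<open>i - 1\<close>, and then its term is minus the contribution of \<open>H \<union> {e}\<close> to \<open>b\<^sub>e\<^sup>i\<^sup>-\<^sup>1\<close>.\<close>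

text \<open>A walk can be shortened so that it crosses the new edge at most once, in one of its two
  directions.\<close>

lemma connected_rel_insert:
  assumes "u \<in> V" "v \<in> V"
  shows "(x, y) \<in> connected_rel V (insert {u, v} H) \<longleftrightarrow>
    (x, y) \<in> connected_rel V H \<or>
    (x, u) \<in> connected_rel V H \<and> (v, y) \<in> connected_rel V H \<or>
    (x, v) \<in> connected_rel V H \<and> (u, y) \<in> connected_rel V H"
proof -
  let ?r = "{(x, y). {x, y} \<in> H}"
  have eq: "{(x, y). {x, y} \<in> insert {u, v} H} = insert (u, v) (insert (v, u) ?r)"
    by (auto simp: doubleton_eq_iff)
  have "sym (?r\<^sup>*)"
    by (rule sym_rtrancl) (auto simp: sym_def insert_commute)
  then have s: "\<And>a b. (a, b) \<in> ?r\<^sup>* \<Longrightarrow> (b, a) \<in> ?r\<^sup>*"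
    by (auto dest: symD)
  have "(x, y) \<in> (insert (u, v) (insert (v, u) ?r))\<^sup>* \<longleftrightarrow>
      (x, y) \<in> ?r\<^sup>* \<or> (x, u) \<in> ?r\<^sup>* \<and> (v, y) \<in> ?r\<^sup>* \<or> (x, v) \<in> ?r\<^sup>* \<and> (u, y) \<in> ?r\<^sup>*"
    \<comment> \<open>Expanding both ordered pairs also yields walks that cross the edge repeatedly;
      these collapse to the three listed cases.\<close>
    unfolding rtrancl_insert using s
    by (auto intro: rtrancl_trans)
  then show ?thesis
    using assms unfolding connected_rel_def eq by auto
qed

text \<open>The new edge merges the classes of its ends and leaves all others alone. If the two
  classes coincide, the formula removes and restores the same class, so no case split is needed
  here.\<close>

lemma quotient_connected_rel_insert:
  fixes V :: "'a set" and H :: "'a set set"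
  defines "R \<equiv> connected_rel V H"
  assumes "u \<in> V" "v \<in> V"
  shows "V // connected_rel V (insert {u, v} H) =
    insert (R `` {u} \<union> R `` {v}) (V // R - {R `` {u}, R `` {v}})"
proof -
  let ?R' = "connected_rel V (insert {u, v} H)"
  let ?A = "R `` {u}" and ?B = "R `` {v}"
  have eqv: "equiv V R"
    unfolding R_def by (rule equiv_connected_rel)
  note R = connected_rel_insert[OF assms(2,3), of _ _ H, folded R_def]
  have s: "\<And>a b. (a, b) \<in> R \<Longrightarrow> (b, a) \<in> R" and t: "\<And>a b c. (a, b) \<in> R \<Longrightarrow> (b, c) \<in> R \<Longrightarrow> (a, c) \<in> R"
    using eqv by (meson equivE symD transD)+
  have r: "\<And>a. a \<in> V \<Longrightarrow> (a, a) \<in> R"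
    using eqv by (meson equivE refl_onD)
  \<comment> \<open>A vertex joined to \<open>u\<close> or \<open>v\<close> now reaches both old
    classes; any other gains nothing, since every new connection passes through \<open>u\<close> and
    \<open>v\<close>.\<close>
  have cls: "?R' `` {x} = (if x \<in> ?A \<union> ?B then ?A \<union> ?B else R `` {x})" for x
  proof -
    have "y \<in> ?R' `` {x} \<longleftrightarrow> y \<in> (if x \<in> ?A \<union> ?B then ?A \<union> ?B else R `` {x})" for y
      by (cases "x \<in> ?A \<union> ?B") (simp_all only: if_True if_False Un_iff Image_singleton_iff R, (metis s t)+)
    then show ?thesis
      by blast
  qed
  have out: "R `` {x} \<noteq> ?A \<and> R `` {x} \<noteq> ?B \<longleftrightarrow> x \<notin> ?A \<union> ?B" if "x \<in> V" for x
    using that assms(2,3) by (auto simp: eq_equiv_class_iff[OF eqv] dest: s)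
  have A: "u \<in> ?A \<union> ?B"
    using r assms(2) by auto
  show ?thesis
  proof (intro equalityI subsetI)
    fix X assume "X \<in> V // ?R'"
    then obtain x where x: "x \<in> V" "X = ?R' `` {x}"
      by (auto elim: quotientE)
    then show "X \<in> insert (?A \<union> ?B) (V // R - {?A, ?B})"
      using cls[of x] out[of x] by (auto simp: quotientI)
  next
    fix X assume "X \<in> insert (?A \<union> ?B) (V // R - {?A, ?B})"
    then consider "X = ?A \<union> ?B" | x where "x \<in> V" "X = R `` {x}" "X \<noteq> ?A" "X \<noteq> ?B"
      by (blast elim: quotientE)
    then show "X \<in> V // ?R'"
    proof cases
      case 1
      then show ?thesis
        using quotientI[OF assms(2), of ?R'] cls[of u] A by simp
    next
      case 2
      then show ?thesis
        using quotientI[of x V ?R'] cls[of x] out[of x] by simp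
    qed
  qed
qed

lemma num_components_insert:
  assumes "finite V" "u \<in> V" "v \<in> V"
  shows "num_components V H = num_components V (insert {u, v} H) \<or>
    num_components V H = num_components V (insert {u, v} H) + 1"
proof -
  define R where "R = connected_rel V H"
  let ?A = "R `` {u}" and ?B = "R `` {v}"
  have eqv: "equiv V R"
    unfolding R_def by (rule equiv_connected_rel)
  have fin: "finite (V // R)"
    using assms(1) eqv by (simp add: finite_quotient equiv_type)
  have AB: "?A \<in> V // R" "?B \<in> V // R"
    using assms by (auto intro: quotientI)
  have Q: "V // connected_rel V (insert {u, v} H) = insert (?A \<union> ?B) (V // R - {?A, ?B})"
    unfolding R_def using assms(2,3) by (rule quotient_connected_rel_insert)
  show ?thesis
  proof (cases "?A = ?B")
    case True
    then have "insert (?A \<union> ?B) (V // R - {?A, ?B}) = V // R"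
      using AB by auto
    then show ?thesis
      using Q by (simp add: num_components_def R_def)
  next
    case False
    \<comment> \<open>The merged class must count as new: as an old class meeting \<open>?A\<close>
      it would equal \<open>?A\<close>, which has been removed.\<close>
    have "?A \<union> ?B \<notin> V // R - {?A, ?B}"
    proof
      assume C: "?A \<union> ?B \<in> V // R - {?A, ?B}"
      have "u \<in> ?A"
        using eqv assms(2) by (rule equiv_class_self)
      then show False
        using quotient_disj[OF eqv, of "?A \<union> ?B" ?A] C AB by blast
    qed
    moreover have "card {?A, ?B} = 2"
      using False by simp
    \<comment> \<open>Guards the truncated subtraction in \<open>card_Diff_subset\<close>.\<close>
    moreover have "card {?A, ?B} \<le> card (V // R)"
      using AB fin by (intro card_mono) auto
    ultimately have "card (insert (?A \<union> ?B) (V // R - {?A, ?B})) + 1 = card (V // R)"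
      using AB fin by (simp add: card_Diff_subset)
    then show ?thesis
      using Q by (simp add: num_components_def R_def)
  qed
qed

lemma num_components_pos:
  assumes "finite V" "V \<noteq> {}"
  shows "num_components V F > 0"
  using assms equiv_type[OF equiv_connected_rel, of V F]
  by (auto simp: num_components_def card_gt_0_iff finite_quotient)

text \<open>This carries out the pairing: \<open>insert a\<close> is injective on
  \<open>Pow A\<close>, and its image consists of the remaining subsets.\<close>

lemma sum_subsets_insert:
  fixes f :: "'a set \<Rightarrow> 'b::comm_monoid_add"
  assumes "finite A" "a \<notin> A"
  shows "(\<Sum>F\<in>Pow (insert a A). f F) = (\<Sum>H\<in>Pow A. f H + f (insert a H))"
proof -
  have "inj_on (insert a) (Pow A)"
    using assms(2) by (auto simp: inj_on_def)
  moreover have "Pow A \<inter> insert a ` Pow A = {}"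
    using assms(2) by auto
  ultimately show ?thesis
    using assms(1) by (simp add: Pow_insert sum.union_disjoint sum.reindex sum.distrib)
qed

theorem lemma2p4:
  fixes V :: "'a set" and E :: "'a set set" and e :: "'a set"
  assumes "finite_simple_graph V E" and "V \<noteq> {}" and "E \<noteq> {}" and "e \<in> E"
  shows "\<forall>i\<ge>1. chrom_coeff V E i = bridge_coeff V E e i - bridge_coeff V E e (i - 1)"
proof (intro allI impI)
  fix i :: nat
  assume i: "i \<ge> 1"
  let ?k = "num_components V"
  define D where "D = E - {e}"
  have finV: "finite V" and edge: "\<And>d. d \<in> E \<Longrightarrow> d \<subseteq> V \<and> card d = 2"
    using assms(1) by (auto simp: finite_simple_graph_def simple_graph_def)
  have finE: "finite E"
    by (rule finite_subset[of _ "Pow V"]) (use finV edge in auto)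
  have D: "E = insert e D" "e \<notin> D" "finite D"
    using assms(4) finE by (auto simp: D_def)
  obtain u v where uv: "e = {u, v}" "u \<in> V" "v \<in> V"
    using edge[OF assms(4)] by (auto simp: card_2_iff)
  \<comment> \<open>Moving the conditions into the summands gives all sums the index set
    \<open>Pow E\<close>, so they can be compared term by term.\<close>
  have chrom: "chrom_coeff V E i = (\<Sum>F\<in>Pow E. if ?k F = i then (- 1) ^ card F else 0)"
    unfolding chrom_coeff_def using finE
    by (simp add: sum.inter_filter[symmetric] Pow_def conj_commute)
  have bridge: "bridge_coeff V E e j =
      (\<Sum>F\<in>Pow E. if is_bridge V F e \<and> ?k F = j then (- 1) ^ card F else 0)" for j
  proof -
    \<comment> \<open>As \<open>V\<close> is nonempty, the value 0 set by convention at index 0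
      agrees with the sum, so \<open>i = 1\<close> is no special case.\<close>
    have "bridge_sets V E e 0 = {}"
      using num_components_pos[OF finV assms(2)] by (auto simp: bridge_sets_def)
    then have "bridge_coeff V E e j = (\<Sum>F\<in>bridge_sets V E e j. (- 1) ^ card F)"
      by (simp add: bridge_coeff_def)
    moreover have "bridge_sets V E e j = {F \<in> Pow E. is_bridge V F e \<and> ?k F = j}"
      by (auto simp: bridge_sets_def)
    ultimately show ?thesis
      using finE by (simp only: sum.inter_filter finite_Pow_iff)
  qed
  show "chrom_coeff V E i = bridge_coeff V E e i - bridge_coeff V E e (i - 1)"
    unfolding chrom bridge sum_subtractf[symmetric] unfolding D(1) sum_subsets_insert[OF D(3,2)]
  proof (rule sum.cong[OF refl])
    fix H assume "H \<in> Pow D"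
    then have H: "e \<notin> H" "finite H"
      using D(2,3) finite_subset by auto
    have "?k H = ?k (insert e H) \<or> ?k H = ?k (insert e H) + 1"
      using num_components_insert[OF finV uv(2,3)] uv(1) by simp
    \<comment> \<open>Since \<open>e\<close> is not in \<open>H\<close>, it is no bridge in
      \<open>H\<close>, and inserting it flips the sign. By \<open>i\<close>, having
      \<open>i - 1\<close> components after insertion means having one less than \<open>i\<close>,
      without truncation.\<close>
    then show "(if ?k H = i then (- 1) ^ card H else 0) +
        (if ?k (insert e H) = i then (- 1) ^ card (insert e H) else 0) =
      (if is_bridge V H e \<and> ?k H = i then (- 1) ^ card H else 0) -
        (if is_bridge V H e \<and> ?k H = i - 1 then (- 1) ^ card H else 0) +
      ((if is_bridge V (insert e H) e \<and> ?k (insert e H) = i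
         then (- 1) ^ card (insert e H) else 0) -
        (if is_bridge V (insert e H) e \<and> ?k (insert e H) = i - 1
         then (- 1) ^ card (insert e H) else (0::int)))"
      using H i by (auto simp: is_bridge_def)
  qed
qed

end
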